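(* Let $A\in\mathbb{R}^{n\times n}$ be a symmetric matrix having at least two distinct eigenvalues, and let $\lambda_1\le\lambda_2\le\dots\le\lambda_n$ be its eigenvalues (counted with multiplicity). Let $q_A:\mathbb{S}^{n-1}\cap\mathbb{R}^n_{++}\to\mathbb{R}$, $q_A(x)=\langle Ax,x\rangle$. Consider the following statements: (i) $q_A$ is spherically quasi-convex. (ii) $A$ is a Z-matrix. (iii) $\lambda_2 I_n-A$ is copositive and there exists an eigenvector $v^1\in\mathbb{R}^n_+$ of $A$ corresponding to the eigenvalue $\lambda_1$ of $A$. (iv) $A$ is a Z-matrix and $\lambda_2\ge a_{ii}$ for any $i\in\{1,\dots,n\}$. (v) $A$ is a Z-matrix, $\lambda_1<\lambda_2$ and $\lambda_2\ge a_{ii}$ for any $i\in\{1,\dots,n\}$. (vi) $A$ is an irreducible Z-matrix and $\lambda_2\ge a_{ii}$ for any $i\in\{1,\dots,n\}$. Then the following implications hold: (v) $\Rightarrow$ (iii), (vi) $\Rightarrow$ (iii), (iii) $\Rightarrow$ (iv), (iii) $\Rightarrow$ (i), and (i) $\Rightarrow$ (ii).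
   Context: $\langle\cdot,\cdot\rangle$ and $\|\cdot\|$ are the canonical inner product and norm on $\mathbb{R}^n$; $\mathbb{S}^{n-1}=\{x\in\mathbb{R}^n:\|x\|=1\}$ with intrinsic distance $d(x,y)=\arccos\langle x,y\rangle$; $\mathbb{R}^n_+$ (resp. $\mathbb{R}^n_{++}$) is the set of vectors with all components nonnegative (resp. positive); $A=(a_{ij})$; $I_n$ is the identity matrix. A matrix $B$ is copositive if $\langle Bx,x\rangle\ge0$ for all $x\in\mathbb{R}^n_+$. A Z-matrix is a matrix with nonpositive off-diagonal elements. A matrix $B\in\mathbb{R}^{n\times n}$ is reducible if there is a permutation matrix $P$ such that $P^{\top}BP=\begin{bmatrix}B_{11}&B_{12}\\0&B_{22}\end{bmatrix}$ with $B_{11}\in\mathbb{R}^{m\times m}$, $B_{22}\in\mathbb{R}^{(n-m)\times(n-m)}$, $0<m<n$; it is irreducible if it is not reducible. A minimal geodesic segment is a constant-speed parametrized arc of a great circle whose length equals the distance $d$ between its endpoints. A set $\mathcal{C}\subseteq\mathbb{S}^{n-1}$ is spherically convex if for any $x,y\in\mathcal{C}$ all minimal geodesic segments joining $x$ to $y$ are contained in $\mathcal{C}$; $\mathbb{S}^{n-1}\cap\mathbb{R}^n_{++}$ is spherically convex. A function $f:\mathcal{C}\to\mathbb{R}$ on a spherically convex set is spherically quasi-convex if for every minimal geodesic segment $\gamma:I\to\mathcal{C}$ ($I\subset\mathbb{R}$ an interval), $f(\gamma(t))\le\max\{f(\gamma(t_1)),f(\gamma(t_2))\}$ for all $t\in[t_1,t_2]\subset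 I$. *)

theory Defs
  imports "HOL-Analysis.Analysis" "HOL-Computational_Algebra.Polynomial"
begin

section \<open>Spherical geometry\<close>

definition sphere_dist :: "real ^ 'n \<Rightarrow> real ^ 'n \<Rightarrow> real" where
  "sphere_dist x y = arccos (x \<bullet> y)"

text \<open>
  The great circle is the unit circle in the plane spanned by the orthonormal vectors \<open>p\<close> and
  \<open>q\<close>. The speed \<open>v\<close> may be taken nonnegative, because \<open>q\<close> can be replaced by \<open>-q\<close>. The arc
  over \<open>{a..b}\<close> has length \<open>v * (b - a)\<close>. Constant segments (\<open>v = 0\<close> or \<open>a = b\<close>) are included.
\<close>

definition minimal_geodesic_segment :: "(real \<Rightarrow> real ^ 'n) \<Rightarrow> real \<Rightarrow> real \<Rightarrow> bool" where
  "minimal_geodesic_segment \<gamma> a b \<longleftrightarrow> a \<le> b \<and>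
     (\<exists>p q v. norm p = 1 \<and> norm q = 1 \<and> p \<bullet> q = 0 \<and> 0 \<le> v \<and>
        (\<forall>t\<in>{a..b}. \<gamma> t = cos (v * (t - a)) *\<^sub>R p + sin (v * (t - a)) *\<^sub>R q) \<and>
        v * (b - a) = sphere_dist (\<gamma> a) (\<gamma> b))"

definition spherically_convex :: "(real ^ 'n) set \<Rightarrow> bool" where
  "spherically_convex C \<longleftrightarrow> C \<subseteq> sphere 0 1 \<and>
     (\<forall>x\<in>C. \<forall>y\<in>C. \<forall>\<gamma> a b. minimal_geodesic_segment \<gamma> a b \<and> \<gamma> a = x \<and> \<gamma> b = y
        \<longrightarrow> \<gamma> ` {a..b} \<subseteq> C)"

text \<open>As for \<open>convex_on\<close>, convexity of the domain is part of the notion.\<close>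

definition spherically_quasiconvex_on :: "(real ^ 'n) set \<Rightarrow> (real ^ 'n \<Rightarrow> real) \<Rightarrow> bool" where
  "spherically_quasiconvex_on C f \<longleftrightarrow> spherically_convex C \<and>
     (\<forall>\<gamma> a b. minimal_geodesic_segment \<gamma> a b \<and> \<gamma> ` {a..b} \<subseteq> C \<longrightarrow>
        (\<forall>t1 t2. a \<le> t1 \<and> t1 \<le> t2 \<and> t2 \<le> b \<longrightarrow>
           (\<forall>t\<in>{t1..t2}. f (\<gamma> t) \<le> max (f (\<gamma> t1)) (f (\<gamma> t2)))))"

definition nonneg_orthant :: "(real ^ 'n) set" where
  "nonneg_orthant = {x. \<forall>i. 0 \<le> x $ i}"

definition pos_orthant :: "(real ^ 'n) set" where
  "pos_orthant = {x. \<forall>i. 0 < x $ i}"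

lemma spherically_convex_pos_orthant:
  "spherically_convex (sphere 0 1 \<inter> pos_orthant :: (real ^ 'n) set)"
  unfolding spherically_convex_def
proof (intro conjI ballI allI impI subsetI; (elim conjE imageE)?)
  fix x y z :: "real ^ 'n" and \<gamma> a b t
  assume C: "x \<in> sphere 0 1 \<inter> pos_orthant" "y \<in> sphere 0 1 \<inter> pos_orthant"
    and seg: "minimal_geodesic_segment \<gamma> a b" and ends: "\<gamma> a = x" "\<gamma> b = y"
    and z: "z = \<gamma> t" and t: "t \<in> {a..b}"
  from seg obtain p q v where pq: "norm p = 1" "norm q = 1" "p \<bullet> q = 0" and v: "0 \<le> v"
    and \<gamma>: "\<And>t. t \<in> {a..b} \<Longrightarrow> \<gamma> t = cos (v * (t - a)) *\<^sub>R p + sin (v * (t - a)) *\<^sub>R q"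
    and d: "v * (b - a) = arccos (x \<bullet> y)" and ab: "a \<le> b"
    unfolding minimal_geodesic_segment_def sphere_dist_def ends by blast
  define D s where "D = v * (b - a)" and "s = v * (t - a)"
  have xy: "0 < x \<bullet> y"
    using C by (auto simp: inner_vec_def pos_orthant_def intro!: sum_pos)
  have "x \<bullet> y \<le> 1"
    using norm_cauchy_schwarz[of x y] C by simp
  with xy have D: "D < pi / 2"
    unfolding D_def d by (simp add: arccos_lt_bounded arccos_less_arccos[of 0, simplified])
  have s: "0 \<le> s" "s \<le> D"
    using v t by (auto simp: s_def D_def intro!: mult_left_mono)
  have xp: "x = p" and yq: "y = cos D *\<^sub>R p + sin D *\<^sub>R q"
    and zt: "z = cos s *\<^sub>R p + sin s *\<^sub>R q"
    using \<gamma>[of a] \<gamma>[of b] \<gamma>[OF t] ab ends z by (auto simp: D_def s_def)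
  have "norm z ^ 2 = 1"
    using pq unfolding zt power2_norm_eq_inner
    by (simp add: inner_simps inner_commute norm_eq_1 flip: power2_eq_square)
  then have "norm z = 1"
    using power2_eq_1_iff[of "norm z"] norm_ge_zero[of z] by linarith
  moreover have "0 < z $ i" for i
  proof (cases "s = 0")
    case True
    then show ?thesis using C xp zt by (simp add: pos_orthant_def)
  next
    case False
    then have sD: "0 < sin D" and ss: "0 < sin s" "0 \<le> sin (D - s)"
      using s D by (auto intro!: sin_gt_zero sin_ge_zero)
    have "sin D * z $ i = sin (D - s) * x $ i + sin s * y $ i"
      unfolding xp yq zt by (simp add: sin_diff algebra_simps)
    also have "\<dots> > 0"
      using ss C by (intro add_nonneg_pos mult_nonneg_nonneg mult_pos_pos)
        (auto simp: pos_orthant_def less_imp_le)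
    finally show ?thesis using sD by (simp add: zero_less_mult_iff)
  qed
  ultimately show "z \<in> sphere 0 1 \<inter> pos_orthant"
    by (simp add: pos_orthant_def)
qed auto

section \<open>Matrices\<close>

definition quadratic_form :: "real ^ 'n ^ 'n \<Rightarrow> real ^ 'n \<Rightarrow> real" where
  "quadratic_form A x = (A *v x) \<bullet> x"

definition copositive :: "real ^ 'n ^ 'n \<Rightarrow> bool" where
  "copositive B \<longleftrightarrow> (\<forall>x\<in>nonneg_orthant. 0 \<le> (B *v x) \<bullet> x)"

definition Z_matrix :: "real ^ 'n ^ 'n \<Rightarrow> bool" where
  "Z_matrix B \<longleftrightarrow> (\<forall>i j. i \<noteq> j \<longrightarrow> B $ i $ j \<le> 0)"

definition permutation_matrix :: "real ^ 'n ^ 'n \<Rightarrow> bool" where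
  "permutation_matrix P \<longleftrightarrow>
     (\<exists>\<pi>. \<pi> permutes UNIV \<and> P = (\<chi> i j. if i = \<pi> j then 1 else 0))"

text \<open>
  The linear order on the index type gives the block structure: the second block consists of the
  indices \<open>i \<ge> k\<close>, and the first one, of the indices \<open>j < k\<close>, is required to be nonempty.
\<close>

definition reducible_matrix :: "real ^ 'n::{finite,linorder} ^ 'n::{finite,linorder} \<Rightarrow> bool" where
  "reducible_matrix B \<longleftrightarrow>
     (\<exists>P k. permutation_matrix P \<and> {j. j < k} \<noteq> {} \<and>
        (\<forall>i\<ge>k. \<forall>j<k. (transpose P ** B ** P) $ i $ j = 0))"

definition irreducible_matrix :: "real ^ 'n::{finite,linorder} ^ 'n::{finite,linorder} \<Rightarrow> bool" where
  "irreducible_matrix B \<longleftrightarrow> \<not> reducible_matrix B"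

definition eigenvector :: "real ^ 'n ^ 'n \<Rightarrow> real ^ 'n \<Rightarrow> real \<Rightarrow> bool" where
  "eigenvector A x c \<longleftrightarrow> x \<noteq> 0 \<and> A *v x = c *\<^sub>R x"

definition eigenvalue :: "real ^ 'n ^ 'n \<Rightarrow> real \<Rightarrow> bool" where
  "eigenvalue A c \<longleftrightarrow> (\<exists>x. eigenvector A x c)"

definition charpoly :: "real ^ 'n ^ 'n \<Rightarrow> real poly" where
  "charpoly A = det (mat [:0, 1:] - (\<chi> i j. [:A $ i $ j:]))"

text \<open>
  \<open>l 1 \<le> \<dots> \<le> l n\<close> are the eigenvalues of \<open>A\<close>, counted with multiplicity; the other values of \<open>l\<close>
  are irrelevant.
\<close>

definition ordered_eigenvalues :: "real ^ 'n ^ 'n \<Rightarrow> (nat \<Rightarrow> real) \<Rightarrow> bool" where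
  "ordered_eigenvalues A l \<longleftrightarrow>
     charpoly A = (\<Prod>k = 1..CARD('n). [:- l k, 1:]) \<and> mono_on {1..CARD('n)} l"

end

theory Submission
  imports Defs
begin

text \<open>
  Write \<open>B = A - c I\<close>. On the orthogonal complement of an eigenvector \<open>v\<close> for \<open>l 1\<close> one has
  \<open>\<langle>A w, w\<rangle> \<ge> l 2 \<parallel>w\<parallel>\<^sup>2\<close>. If \<open>v\<close> is nonnegative, \<open>x\<close> and \<open>y\<close> are positive unit vectors
  and \<open>q(x), q(y) \<le> c < l 2\<close>, then \<open>w = \<langle>y,v\<rangle> x - \<langle>x,v\<rangle> y\<close> lies in this complement, and expanding
  \<open>\<langle>B w, w\<rangle> \<ge> 0\<close> gives \<open>\<langle>B x, y\<rangle> \<le> 0\<close>; hence \<open>B\<close> is nonpositive on the cone spanned by \<open>x\<close> and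
  \<open>y\<close>. For \<open>c \<ge> l 2\<close> copositivity suffices.

  Conversely, quasi-convexity along the geodesic from \<open>x\<close> to \<open>y\<close> has a first-order consequence
  that is symmetric in \<open>x\<close> and \<open>y\<close>, namely
  \<open>\<langle>A x, y\<rangle> \<le> \<langle>x, y\<rangle> max (q(x)) (q(y))\<close>. Letting \<open>x\<close> and \<open>y\<close> tend to two different
  coordinate vectors yields \<open>a\<^sub>i\<^sub>j \<le> 0\<close>.

  Finally, if \<open>A\<close> is a Z-matrix and \<open>u\<close> minimizes the Rayleigh quotient, then so does its
  componentwise absolute value, which is therefore a nonnegative eigenvector for \<open>l 1\<close>.
\<close>

section \<open>Symmetric matrices and Rayleigh quotients\<close>

lemma symmetric_matrix_inner:
  fixes A :: "real ^ 'n ^ 'n"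
  assumes "transpose A = A"
  shows "(A *v x) \<bullet> y = (A *v y) \<bullet> x"
  by (metis assms dot_lmul_matrix inner_commute transpose_matrix_vector)

lemma quadratic_form_add:
  fixes A :: "real ^ 'n ^ 'n"
  assumes "transpose A = A"
  shows "quadratic_form A (a *\<^sub>R x + b *\<^sub>R y) =
    a\<^sup>2 * quadratic_form A x + 2 * a * b * ((A *v x) \<bullet> y) + b\<^sup>2 * quadratic_form A y"
  using symmetric_matrix_inner[OF assms, of x y]
  by (simp add: quadratic_form_def matrix_vector_right_distrib matrix_vector_mult_scaleR
      inner_simps power2_eq_square algebra_simps)

lemma quadratic_form_scaleR:
  "quadratic_form A (a *\<^sub>R x) = a\<^sup>2 * quadratic_form A x"
  by (simp add: quadratic_form_def matrix_vector_mult_scaleR power2_eq_square)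

lemma quadratic_form_eq_sum:
  "quadratic_form A x = (\<Sum>i\<in>UNIV. \<Sum>j\<in>UNIV. A $ i $ j * (x $ i * x $ j))"
  by (simp add: quadratic_form_def inner_vec_def matrix_vector_mult_def sum_distrib_left
      algebra_simps)

lemma nonneg_quadratic_imp_linear_coeff_0:
  fixes a b :: real
  assumes "\<And>t. 0 \<le> 2 * t * a + t\<^sup>2 * b"
  shows "a = 0"
proof (rule ccontr)
  assume "a \<noteq> 0"
  \<comment> \<open>With this \<open>d\<close>, the quadratic term cannot outweigh the negative
    linear term at \<open>t = - a / d\<close>.\<close>
  define d where "d = \<bar>b\<bar> + 1"
  have d: "0 < d" "b < d" by (auto simp: d_def)
  have "0 \<le> 2 * (- a / d) * a + (- a / d)\<^sup>2 * b" by (rule assms)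
  also have "\<dots> = (a\<^sup>2 / d\<^sup>2) * (b - 2 * d)"
    using d by (simp add: field_simps power2_eq_square)
  also have "\<dots> < 0"
    using d \<open>a \<noteq> 0\<close> by (intro mult_pos_neg) auto
  finally show False by simp
qed

text \<open>First variation: the residual \<open>w = A *v u - m *\<^sub>R u\<close> stays in
  \<open>S\<close>, and moving \<open>u\<close> to \<open>u + t *\<^sub>R w\<close> changes
  \<open>quadratic_form A x - m * (norm x)\<^sup>2\<close>, which is nonnegative on \<open>S\<close>
  and zero at \<open>u\<close>, to first order by \<open>2 * t * (w \<bullet> w)\<close>. So
  \<open>w\<close> vanishes.\<close>

lemma rayleigh_minimizer_imp_eigen:
  fixes A :: "real ^ 'n ^ 'n"
  assumes sym: "transpose A = A" and S: "subspace S" and inv: "\<And>x. x \<in> S \<Longrightarrow> A *v x \<in> S"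
    and u: "u \<in> S" "quadratic_form A u = m * (norm u)\<^sup>2"
    and min: "\<And>x. x \<in> S \<Longrightarrow> m * (norm x)\<^sup>2 \<le> quadratic_form A x"
  shows "A *v u = m *\<^sub>R u"
proof -
  define w where "w = A *v u - m *\<^sub>R u"
  have wS: "w \<in> S"
    unfolding w_def using S u inv by (intro subspace_diff subspace_scale) auto
  have "0 \<le> 2 * t * (w \<bullet> w) + t\<^sup>2 * (quadratic_form A w - m * (norm w)\<^sup>2)" for t
  proof -
    \<comment> \<open>The factor \<open>1\<close> gives the argument the shape that
      \<open>quadratic_form_add\<close> expects.\<close>
    have "m * (norm (1 *\<^sub>R u + t *\<^sub>R w))\<^sup>2 \<le> quadratic_form A (1 *\<^sub>R u + t *\<^sub>R w)"
      using S u wS by (intro min subspace_add subspace_scale) auto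
    moreover have "(norm (1 *\<^sub>R u + t *\<^sub>R w))\<^sup>2 = (norm u)\<^sup>2 + 2 * t * (u \<bullet> w) + t\<^sup>2 * (norm w)\<^sup>2"
      unfolding power2_norm_eq_inner
      by (simp add: inner_simps inner_commute power2_eq_square algebra_simps)
    moreover have "(A *v u) \<bullet> w = w \<bullet> w + m * (u \<bullet> w)"
      using inner_add_left[of w "m *\<^sub>R u" w] by (simp add: w_def)
    ultimately show ?thesis
      using u(2) unfolding quadratic_form_add[OF sym] by (simp add: algebra_simps)
  qed
  then have "w \<bullet> w = 0"
    by (rule nonneg_quadratic_imp_linear_coeff_0)
  then show ?thesis by (simp add: w_def)
qed

text \<open>Compactness of the unit sphere of \<open>S\<close> gives a minimizer, \<open>w\<close>
  makes that sphere nonempty, and homogeneity of degree 2 extends the bound to all of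
  \<open>S\<close>.\<close>

lemma rayleigh_minimum_exists:
  fixes A :: "real ^ 'n ^ 'n"
  assumes S: "subspace S" and "w \<in> S" "w \<noteq> 0"
  obtains u where "u \<in> S" "norm u = 1"
    "\<And>x. x \<in> S \<Longrightarrow> quadratic_form A u * (norm x)\<^sup>2 \<le> quadratic_form A x"
proof -
  have "compact (sphere 0 1 \<inter> S)"
    using closed_subspace[OF S] by (intro compact_Int_closed) auto
  moreover have "(1 / norm w) *\<^sub>R w \<in> sphere 0 1 \<inter> S"
    using assms by (auto intro: subspace_scale)
  moreover have "continuous_on (sphere 0 1 \<inter> S) (quadratic_form A)"
    unfolding quadratic_form_def
    by (intro continuous_intros matrix_vector_mult_linear_continuous_on)
  ultimately obtain u where u: "u \<in> sphere 0 1 \<inter> S"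
    and min: "\<And>x. x \<in> sphere 0 1 \<inter> S \<Longrightarrow> quadratic_form A u \<le> quadratic_form A x"
    using continuous_attains_inf[of "sphere 0 1 \<inter> S" "quadratic_form A"] by blast
  show thesis
  proof
    fix x assume x: "x \<in> S"
    show "quadratic_form A u * (norm x)\<^sup>2 \<le> quadratic_form A x"
    proof (cases "x = 0")
      case False
      have "quadratic_form A u \<le> quadratic_form A ((1 / norm x) *\<^sub>R x)"
        using x S False by (intro min) (auto intro: subspace_scale)
      then show ?thesis
        using False by (simp add: quadratic_form_scaleR field_simps)
    qed (simp add: quadratic_form_def)
  qed (use u in auto)
qed

section \<open>Eigenvalues and the characteristic polynomial\<close>

text \<open>Evaluation at \<open>t\<close> is a ring homomorphism, so it commutes with the Leibniz
  expansion.\<close>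

lemma poly_charpoly: "poly (charpoly A) t = det (t *\<^sub>R mat 1 - A)"
  unfolding charpoly_def det_def
  by (auto simp: poly_sum poly_prod mat_def intro!: sum.cong prod.cong)

lemma poly_charpoly_eq_0_iff: "poly (charpoly A) t = 0 \<longleftrightarrow> eigenvalue A t"
proof -
  have "poly (charpoly A) t = 0 \<longleftrightarrow> \<not> invertible (t *\<^sub>R mat 1 - A)"
    by (simp add: poly_charpoly invertible_det_nz)
  also have "\<dots> \<longleftrightarrow> (\<exists>x. x \<noteq> 0 \<and> (t *\<^sub>R mat 1 - A) *v x = 0)"
    by (auto simp: invertible_left_inverse matrix_left_invertible_ker)
  also have "\<dots> \<longleftrightarrow> eigenvalue A t"
    by (auto simp: eigenvalue_def eigenvector_def matrix_vector_mult_diff_rdistrib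
        scaleR_matrix_vector_assoc[symmetric])
  finally show ?thesis .
qed

section \<open>Repeated roots of the characteristic polynomial from orthogonal eigenvectors\<close>

lemma det_mult_columns:
  fixes M :: "real ^ 'n ^ 'n"
  shows "det (\<chi> r k. d k * M $ r $ k) = (\<Prod>k\<in>UNIV. d k) * det M"
proof -
  define E :: "real ^ 'n ^ 'n" where "E = (\<chi> i j. if i = j then d i else 0)"
  have "(\<chi> r k. d k * M $ r $ k) = M ** E"
    by (simp add: vec_eq_iff matrix_matrix_mult_def E_def if_distrib cong: if_cong)
  moreover have "det E = (\<Prod>k\<in>UNIV. d k)"
    by (subst det_diagonal) (auto simp: E_def)
  ultimately show ?thesis
    by (simp add: det_mul)
qed

lemma det_mult_two_columns:
  fixes M :: "real ^ 'n ^ 'n"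
  assumes "i \<noteq> j"
  shows "det (\<chi> r k. (if k = i \<or> k = j then s else 1) * M $ r $ k) = s\<^sup>2 * det M"
proof -
  have "(\<Prod>k\<in>UNIV. if k = i \<or> k = j then s else 1) = (\<Prod>k\<in>{i, j}. s)"
    by (intro prod.mono_neutral_cong_right) auto
  then show ?thesis
    using assms by (simp add: det_mult_columns power2_eq_square)
qed

text \<open>
  If \<open>M\<close> is invertible and has two eigenvectors for \<open>c\<close> among its columns, then the
  corresponding columns of \<open>(t I - A) M\<close> are divisible by \<open>t - c\<close>.
\<close>

lemma multiple_eigenvalue_charpoly:
  fixes A :: "real ^ 'n ^ 'n"
  assumes u: "eigenvector A u c" and v: "eigenvector A v c" and uv: "u \<bullet> v = 0"
  obtains g where "isCont g c" "\<And>t. poly (charpoly A) t = (t - c)\<^sup>2 * g t"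
proof -
  obtain i where i: "u $ i \<noteq> 0"
    using u by (auto simp: eigenvector_def vec_eq_iff)
  \<comment> \<open>Clearing coordinate \<open>i\<close> keeps the eigenvalue; \<open>w\<close> is
    nonzero because \<open>v\<close> is orthogonal to \<open>u\<close>.\<close>
  define w where "w = v - (v $ i / u $ i) *\<^sub>R u"
  have "w \<bullet> v = v \<bullet> v"
    using uv by (simp add: w_def inner_simps)
  then have "w \<noteq> 0"
    using v by (auto simp: eigenvector_def)
  have wi: "w $ i = 0"
    using i by (simp add: w_def)
  with \<open>w \<noteq> 0\<close> obtain j where j: "w $ j \<noteq> 0" "i \<noteq> j"
    by (metis vec_eq_iff zero_index)
  have eig: "A *v u = c *\<^sub>R u" "A *v w = c *\<^sub>R w"
    using u v by (auto simp: eigenvector_def w_def matrix_vector_mult_diff_distrib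
        matrix_vector_mult_scaleR scaleR_diff_right)
  \<comment> \<open>\<open>M\<close> is the identity with columns \<open>i\<close> and
    \<open>j\<close> replaced by \<open>u\<close> and \<open>w\<close>; \<open>N t\<close> is
    \<open>(t *\<^sub>R mat 1 - A) ** M\<close> with a factor \<open>t - c\<close> taken out of
    these two columns.\<close>
  define col where "col k = (if k = i then u else if k = j then w else axis k 1)" for k
  define M :: "real ^ 'n ^ 'n" where "M = (\<chi> r k. col k $ r)"
  define N :: "real \<Rightarrow> real ^ 'n ^ 'n" where
    "N t = (\<chi> r k. if k = i \<or> k = j then col k $ r else ((t *\<^sub>R mat 1 - A) *v col k) $ r)" for t
  \<comment> \<open>Row \<open>i\<close> of \<open>M *v x = 0\<close> gives \<open>x $ i = 0\<close>
    because \<open>w $ i = 0\<close>, row \<open>j\<close> then gives \<open>x $ j = 0\<close>, and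
    the other rows follow.\<close>
  have "x = 0" if "M *v x = 0" for x
  proof -
    have eq: "(\<Sum>k\<in>UNIV. col k $ r * x $ k) = 0" for r
      using that by (simp add: M_def matrix_vector_mult_def vec_eq_iff)
    have split: "(\<Sum>k\<in>UNIV. col k $ r * x $ k) =
        u $ r * x $ i + w $ r * x $ j + (if r = i \<or> r = j then 0 else x $ r)" for r
    proof -
      have "(\<Sum>k\<in>UNIV. col k $ r * x $ k) =
        (\<Sum>k\<in>UNIV. (if k = i then u $ r * x $ i else 0) + (if k = j then w $ r * x $ j else 0)
           + (if k = r then if r = i \<or> r = j then 0 else x $ r else 0))"
        using j(2) by (intro sum.cong) (auto simp: col_def axis_def)
      then show ?thesis by (simp add: sum.distrib)
    qed
    have "x $ i = 0"
      using eq[of i] i wi unfolding split by simp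
    moreover from this have "x $ j = 0"
      using eq[of j] j unfolding split by simp
    ultimately have "x $ r = 0" for r
      using eq[of r] unfolding split by (auto split: if_splits)
    then show ?thesis by (simp add: vec_eq_iff)
  qed
  then have "det M \<noteq> 0"
    by (metis invertible_det_nz invertible_left_inverse matrix_left_invertible_ker)
  have fact: "poly (charpoly A) t * det M = (t - c)\<^sup>2 * det (N t)" for t
  proof -
    have "((t *\<^sub>R mat 1 - A) ** M) $ r $ k = ((t *\<^sub>R mat 1 - A) *v col k) $ r" for r k
      by (simp add: matrix_matrix_mult_def matrix_vector_mult_def M_def)
    moreover have "(t *\<^sub>R mat 1 - A) *v col k = (t - c) *\<^sub>R col k" if "k = i \<or> k = j" for k
      using that eig by (auto simp: col_def matrix_vector_mult_diff_rdistrib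
          scaleR_matrix_vector_assoc[symmetric] scaleR_diff_left)
    ultimately have "(t *\<^sub>R mat 1 - A) ** M =
        (\<chi> r k. (if k = i \<or> k = j then t - c else 1) * N t $ r $ k)"
      by (simp add: vec_eq_iff N_def)
    then have "det ((t *\<^sub>R mat 1 - A) ** M) = (t - c)\<^sup>2 * det (N t)"
      by (simp only: det_mult_two_columns[OF j(2)])
    then show ?thesis
      by (simp add: det_mul poly_charpoly)
  qed
  show thesis
  proof
    show "poly (charpoly A) t = (t - c)\<^sup>2 * (det (N t) / det M)" for t
      using fact[of t] \<open>det M \<noteq> 0\<close> by (simp add: field_simps)
    have "isCont (\<lambda>t. N t $ r $ k) c" for r k
      by (cases "k = i \<or> k = j")
        (auto simp: N_def matrix_vector_mult_def intro!: continuous_intros)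
    then show "isCont (\<lambda>t. det (N t) / det M) c"
      using \<open>det M \<noteq> 0\<close> unfolding det_def
      by (intro continuous_divide continuous_sum continuous_mult continuous_prod continuous_const)
  qed
qed

text \<open>Removing the factor of one index \<open>i\<close> leaves a product equal to
  \<open>(t - c) * g t\<close> for \<open>t \<noteq> c\<close>. Its limit at \<open>c\<close> is 0,
  so by continuity another factor vanishes there. Continuity of \<open>g\<close> takes the place of
  polynomial divisibility.\<close>

lemma double_root_two_factors:
  fixes l :: "nat \<Rightarrow> real"
  assumes I: "finite I" and "isCont g c"
    and eq: "\<And>t. (\<Prod>k\<in>I. t - l k) = (t - c)\<^sup>2 * g t"
  obtains i j where "i \<in> I" "j \<in> I" "i \<noteq> j" "l i = c" "l j = c"
proof -
  have "(\<Prod>k\<in>I. c - l k) = 0" by (simp add: eq)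
  then obtain i where i: "i \<in> I" "l i = c"
    using I by auto
  have ev: "(\<Prod>k\<in>I - {i}. t - l k) = (t - c) * g t" if "t \<noteq> c" for t
    using eq[of t] that i by (simp add: prod.remove[OF I i(1)] power2_eq_square)
  have "((\<lambda>t. (t - c) * g t) \<longlongrightarrow> (c - c) * g c) (at c)"
    using assms(2) by (intro tendsto_intros) (auto simp: isCont_def)
  then have "((\<lambda>t. \<Prod>k\<in>I - {i}. t - l k) \<longlongrightarrow> 0) (at c)"
    by (subst tendsto_cong[where g = "\<lambda>t. (t - c) * g t"])
      (auto simp: eventually_at_filter ev)
  moreover have "((\<lambda>t. \<Prod>k\<in>I - {i}. t - l k) \<longlongrightarrow> (\<Prod>k\<in>I - {i}. c - l k)) (at c)"
    by (intro tendsto_intros)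
  ultimately have "(\<Prod>k\<in>I - {i}. c - l k) = 0"
    using tendsto_unique trivial_limit_at by blast
  then obtain j where "j \<in> I - {i}" "l j = c"
    using I by auto
  with i show thesis using that by blast
qed

section \<open>The two smallest eigenvalues and their variational description\<close>

lemma ordered_eigenvalues_poly:
  assumes "ordered_eigenvalues A l"
  shows "poly (charpoly (A :: real ^ 'n ^ 'n)) t = (\<Prod>k = 1..CARD('n). t - l k)"
  using assms by (simp add: ordered_eigenvalues_def poly_prod)

lemma ordered_eigenvalues_eigenvalue_iff:
  fixes A :: "real ^ 'n ^ 'n"
  assumes "ordered_eigenvalues A l"
  shows "eigenvalue A c \<longleftrightarrow> (\<exists>k\<in>{1..CARD('n)}. l k = c)"
  unfolding poly_charpoly_eq_0_iff[symmetric] ordered_eigenvalues_poly[OF assms] by auto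

lemma ordered_eigenvalues_least:
  fixes A :: "real ^ 'n ^ 'n"
  assumes "ordered_eigenvalues A l"
  shows "eigenvalue A (l 1)" and "eigenvalue A c \<Longrightarrow> l 1 \<le> c"
proof -
  have "1 \<in> {1..CARD('n)}" by (simp add: Suc_leI)
  then show "eigenvalue A (l 1)" and "eigenvalue A c \<Longrightarrow> l 1 \<le> c"
    unfolding ordered_eigenvalues_eigenvalue_iff[OF assms]
    using assms by (auto simp: ordered_eigenvalues_def intro!: mono_onD[of "{Suc 0..CARD('n)}" l])
qed

text \<open>If \<open>c = l 1\<close>, the two orthogonal eigenvectors make \<open>c\<close> a
  double root, so two distinct indices carry \<open>c\<close> and at least one exceeds 1; if
  \<open>c \<noteq> l 1\<close>, any index of \<open>c\<close> does.\<close>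

lemma ordered_eigenvalues_second_le:
  fixes A :: "real ^ 'n ^ 'n"
  assumes l: "ordered_eigenvalues A l"
    and v: "eigenvector A v (l 1)" and u: "eigenvector A u c" and vu: "v \<bullet> u = 0"
  shows "l 2 \<le> c"
proof -
  have "\<exists>k\<in>{1..CARD('n)}. 2 \<le> k \<and> l k = c"
  proof (cases "c = l 1")
    case True
    obtain g where "isCont g c" "\<And>t. poly (charpoly A) t = (t - c)\<^sup>2 * g t"
      using multiple_eigenvalue_charpoly[of A v c u] v u vu True by metis
    then obtain i j where "i \<in> {1..CARD('n)}" "j \<in> {1..CARD('n)}" "i \<noteq> j" "l i = c" "l j = c"
      unfolding ordered_eigenvalues_poly[OF l] by (rule double_root_two_factors[rotated]) auto
    then show ?thesis
      by (cases "i = 1") (auto simp: Suc_le_eq numeral_2_eq_2 intro: bexI[of _ i] bexI[of _ j])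
  next
    case False
    have "eigenvalue A c" using u by (auto simp: eigenvalue_def)
    then obtain k where k: "k \<in> {1..CARD('n)}" "l k = c"
      using ordered_eigenvalues_eigenvalue_iff[OF l] by blast
    with False have "k \<noteq> 1" by auto
    with k show ?thesis by (intro bexI[of _ k]) auto
  qed
  then obtain k where k: "k \<in> {1..CARD('n)}" "2 \<le> k" "l k = c" by blast
  then have "l 2 \<le> l k"
    using l by (intro mono_onD[of "{1..CARD('n)}" l]) (auto simp: ordered_eigenvalues_def)
  with k show ?thesis by simp
qed

text \<open>Half of the Courant-Fischer principle: the Rayleigh minimum over the hyperplane
  orthogonal to \<open>v\<close> is attained at an eigenvector, whose eigenvalue is at least
  \<open>l 2\<close>. The case \<open>l 1 = l 2\<close> is covered.\<close>

lemma second_eigenvalue_le_quadratic_form: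
  fixes A :: "real ^ 'n ^ 'n"
  assumes sym: "transpose A = A" and l: "ordered_eigenvalues A l"
    and v: "eigenvector A v (l 1)" and wv: "v \<bullet> w = 0"
  shows "l 2 * (norm w)\<^sup>2 \<le> quadratic_form A w"
proof (cases "w = 0")
  case True
  then show ?thesis by (simp add: quadratic_form_def)
next
  case False
  let ?S = "{x. v \<bullet> x = 0}"
  have S: "subspace ?S" by (rule subspace_hyperplane)
  \<comment> \<open>Symmetry keeps the hyperplane invariant:
    \<open>(A *v x) \<bullet> v = l 1 * (v \<bullet> x)\<close>.\<close>
  have inv: "A *v x \<in> ?S" if "x \<in> ?S" for x
    using that v symmetric_matrix_inner[OF sym, of x v]
    by (simp add: eigenvector_def inner_commute)
  obtain u where u: "u \<in> ?S" "norm u = 1"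
    and min: "\<And>x. x \<in> ?S \<Longrightarrow> quadratic_form A u * (norm x)\<^sup>2 \<le> quadratic_form A x"
    using rayleigh_minimum_exists[OF S _ False] wv by blast
  have "A *v u = quadratic_form A u *\<^sub>R u"
    using u min by (intro rayleigh_minimizer_imp_eigen[OF sym S inv]) auto
  then have "eigenvector A u (quadratic_form A u)"
    using u by (auto simp: eigenvector_def)
  then have "l 2 \<le> quadratic_form A u"
    using ordered_eigenvalues_second_le[OF l v] u by blast
  then have "l 2 * (norm w)\<^sup>2 \<le> quadratic_form A u * (norm w)\<^sup>2"
    by (intro mult_right_mono) auto
  also have "\<dots> \<le> quadratic_form A w"
    using wv by (intro min) auto
  finally show ?thesis .
qed

text \<open>Taking absolute values of the coordinates preserves the norm and the diagonal terms and
  cannot increase the off-diagonal ones, whose coefficients are nonpositive.\<close>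

lemma Z_matrix_nonneg_eigenvector:
  fixes A :: "real ^ 'n ^ 'n"
  assumes sym: "transpose A = A" and l: "ordered_eigenvalues A l" and Z: "Z_matrix A"
  obtains x where "x \<in> nonneg_orthant" "eigenvector A x (l 1)"
proof -
  obtain y where y: "eigenvector A y (l 1)"
    using ordered_eigenvalues_least(1)[OF l] by (auto simp: eigenvalue_def)
  then have "y \<noteq> 0" by (simp add: eigenvector_def)
  then obtain u where u: "norm u = 1"
    and min: "\<And>x. quadratic_form A u * (norm x)\<^sup>2 \<le> quadratic_form A x"
    using rayleigh_minimum_exists[OF subspace_UNIV UNIV_I] by (metis UNIV_I)
  define m where "m = quadratic_form A u"
  define x :: "real ^ 'n" where "x = (\<chi> i. \<bar>u $ i\<bar>)"
  have nx: "norm x = 1"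
    using u by (simp add: x_def norm_vec_def L2_set_def)
  have "quadratic_form A x \<le> m"
    unfolding m_def quadratic_form_eq_sum
  proof (intro sum_mono)
    fix i j
    show "A $ i $ j * (x $ i * x $ j) \<le> A $ i $ j * (u $ i * u $ j)"
    proof (cases "i = j")
      case True
      then show ?thesis by (simp add: x_def)
    next
      case False
      then show ?thesis
        using Z by (intro mult_left_mono_neg) (auto simp: Z_matrix_def x_def simp flip: abs_mult)
    qed
  qed
  with min[of x] nx have qx: "quadratic_form A x = m * (norm x)\<^sup>2"
    by (simp add: m_def)
  have "A *v x = m *\<^sub>R x"
    using qx min by (intro rayleigh_minimizer_imp_eigen[OF sym subspace_UNIV]) (auto simp: m_def)
  then have ev: "eigenvector A x m"
    using nx by (auto simp: eigenvector_def)
  have "l 1 \<le> m"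
    using ev ordered_eigenvalues_least(2)[OF l] by (auto simp: eigenvalue_def)
  \<comment> \<open>Testing the minimum with an eigenvector for \<open>l 1\<close> identifies it
    with \<open>l 1\<close>.\<close>
  moreover have "m * (norm y)\<^sup>2 \<le> l 1 * (norm y)\<^sup>2"
    using min[of y] y
    by (simp add: m_def eigenvector_def quadratic_form_def power2_norm_eq_inner)
  then have "m \<le> l 1"
    using \<open>y \<noteq> 0\<close> by simp
  ultimately have "eigenvector A x (l 1)"
    using ev by simp
  then show thesis
    using that[of x] by (simp add: nonneg_orthant_def x_def)
qed

section \<open>Copositivity\<close>

lemma copositive_shift_iff:
  "copositive (c *\<^sub>R mat 1 - A) \<longleftrightarrow>
    (\<forall>x\<in>nonneg_orthant. quadratic_form A x \<le> c * (norm x)\<^sup>2)"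
  by (simp add: copositive_def quadratic_form_def matrix_vector_mult_diff_rdistrib
      scaleR_matrix_vector_assoc[symmetric] inner_simps power2_norm_eq_inner)

text \<open>Coordinate vectors lie in the closed orthant, so they are admissible test
  vectors.\<close>

lemma copositive_shift_diagonal_le:
  assumes "copositive (c *\<^sub>R mat 1 - A)"
  shows "A $ i $ i \<le> c"
proof -
  have "axis i 1 \<in> nonneg_orthant"
    by (simp add: nonneg_orthant_def axis_def)
  then have "quadratic_form A (axis i 1) \<le> c * (norm (axis i 1 :: real ^ 'a))\<^sup>2"
    using assms unfolding copositive_shift_iff by blast
  then show ?thesis
    by (simp add: quadratic_form_def inner_axis matrix_vector_mult_basis column_def)
qed

lemma nonneg_entries_imp_copositive:
  assumes "\<And>i j. 0 \<le> B $ i $ j"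
  shows "copositive B"
  using assms
  by (auto simp: copositive_def nonneg_orthant_def inner_vec_def matrix_vector_mult_def
      intro!: sum_nonneg mult_nonneg_nonneg)

lemma Z_matrix_shift_copositive:
  assumes "Z_matrix A" "\<And>i. A $ i $ i \<le> c"
  shows "copositive (c *\<^sub>R mat 1 - A)"
  using assms by (intro nonneg_entries_imp_copositive) (auto simp: Z_matrix_def mat_def)

section \<open>Quasi-convexity\<close>

lemma pos_orthant_inner_nonneg_pos:
  assumes "x \<in> pos_orthant" "v \<in> nonneg_orthant" "v \<noteq> 0"
  shows "0 < x \<bullet> v"
proof -
  obtain i where i: "v $ i \<noteq> 0" using assms(3) by (auto simp: vec_eq_iff)
  then have "0 < x $ i * v $ i"
    using assms by (auto simp: pos_orthant_def nonneg_orthant_def less_le)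
  moreover have "0 \<le> x $ j * v $ j" for j
    using assms by (auto simp: pos_orthant_def nonneg_orthant_def less_imp_le)
  ultimately show ?thesis
    unfolding inner_vec_def by (intro sum_pos2[where i = i]) auto
qed

lemma pos_orthant_inner_pos:
  assumes "x \<in> pos_orthant" "y \<in> pos_orthant"
  shows "0 < x \<bullet> y"
  using assms by (auto simp: inner_vec_def pos_orthant_def intro!: sum_pos)

text \<open>Nonnegativity of \<open>A - c I\<close> on the hyperplane orthogonal to \<open>v\<close>
  forces the mixed term \<open>p\<close> to be nonpositive, so all three terms of the expansion on
  the cone are.\<close>

lemma quadratic_form_le_on_cone:
  fixes A :: "real ^ 'n ^ 'n"
  assumes sym: "transpose A = A"
    and v: "v \<in> nonneg_orthant" "v \<noteq> 0"
    and perp: "\<And>w. v \<bullet> w = 0 \<Longrightarrow> c * (norm w)\<^sup>2 \<le> quadratic_form A w"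
    and x: "x \<in> pos_orthant" "quadratic_form A x \<le> c * (norm x)\<^sup>2"
    and y: "y \<in> pos_orthant" "quadratic_form A y \<le> c * (norm y)\<^sup>2"
    and s: "0 \<le> s" "0 \<le> r"
  shows "quadratic_form A (s *\<^sub>R x + r *\<^sub>R y) \<le> c * (norm (s *\<^sub>R x + r *\<^sub>R y))\<^sup>2"
proof -
  have norm: "(norm (a *\<^sub>R x + b *\<^sub>R y))\<^sup>2 = a\<^sup>2 * (norm x)\<^sup>2 + 2 * a * b * (x \<bullet> y) + b\<^sup>2 * (norm y)\<^sup>2"
    for a b
    unfolding power2_norm_eq_inner
    by (simp add: inner_simps inner_commute power2_eq_square algebra_simps)
  define a b where "a = x \<bullet> v" and "b = y \<bullet> v"
  have ab: "0 < a" "0 < b"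
    unfolding a_def b_def using x y v by (auto intro: pos_orthant_inner_nonneg_pos)
  define qx qy p where "qx = quadratic_form A x - c * (norm x)\<^sup>2"
    and "qy = quadratic_form A y - c * (norm y)\<^sup>2" and "p = (A *v x) \<bullet> y - c * (x \<bullet> y)"
  have expand: "quadratic_form A (a *\<^sub>R x + b *\<^sub>R y) - c * (norm (a *\<^sub>R x + b *\<^sub>R y))\<^sup>2
    = a\<^sup>2 * qx + 2 * a * b * p + b\<^sup>2 * qy" for a b
    unfolding quadratic_form_add[OF sym] norm qx_def qy_def p_def by (simp add: algebra_simps)
  have q: "qx \<le> 0" "qy \<le> 0"
    using x y by (auto simp: qx_def qy_def)
  \<comment> \<open>The coefficients are chosen for orthogonality to \<open>v\<close>; the minus
    sign turns the lower bound into an upper bound for \<open>p\<close>.\<close>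
  have "v \<bullet> (b *\<^sub>R x + (- a) *\<^sub>R y) = 0"
    by (simp add: a_def b_def inner_simps inner_commute)
  from perp[OF this] have "2 * (a * b) * p \<le> b\<^sup>2 * qx + a\<^sup>2 * qy"
    using expand[of b "- a"] by (simp add: algebra_simps)
  also have "\<dots> \<le> 0"
    using q by (intro add_nonpos_nonpos mult_nonneg_nonpos) auto
  finally have "p \<le> 0"
    using ab by (simp add: mult_le_0_iff)
  then have "s\<^sup>2 * qx + 2 * s * r * p + r\<^sup>2 * qy \<le> 0"
    using q s by (intro add_nonpos_nonpos mult_nonneg_nonpos) auto
  then show ?thesis
    using expand[of s r] by linarith
qed

text \<open>Let \<open>c\<close> be the larger endpoint value. For \<open>m \<le> c\<close>
  copositivity bounds every value by \<open>m\<close>; for \<open>c < m\<close> the cone estimate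
  applies with \<open>c\<close>, since each point of the arc is a nonnegative combination of the
  endpoints.\<close>

lemma spherically_quasiconvex_quadratic_form:
  fixes A :: "real ^ 'n ^ 'n"
  assumes sym: "transpose A = A"
    and cop: "copositive (m *\<^sub>R mat 1 - A)"
    and v: "v \<in> nonneg_orthant" "v \<noteq> 0"
    and perp: "\<And>w. v \<bullet> w = 0 \<Longrightarrow> m * (norm w)\<^sup>2 \<le> quadratic_form A w"
  shows "spherically_quasiconvex_on (sphere 0 1 \<inter> pos_orthant) (quadratic_form A)"
  unfolding spherically_quasiconvex_on_def
proof (intro conjI spherically_convex_pos_orthant allI impI ballI; elim conjE)
  fix \<gamma> :: "real \<Rightarrow> real ^ 'n" and a b t1 t2 t
  assume seg: "minimal_geodesic_segment \<gamma> a b" and C: "\<gamma> ` {a..b} \<subseteq> sphere 0 1 \<inter> pos_orthant"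
    and ord: "a \<le> t1" "t1 \<le> t2" "t2 \<le> b" and t: "t \<in> {t1..t2}"
  from seg obtain p q s where s: "0 \<le> s"
    and \<gamma>: "\<And>t. t \<in> {a..b} \<Longrightarrow> \<gamma> t = cos (s * (t - a)) *\<^sub>R p + sin (s * (t - a)) *\<^sub>R q"
    and d: "s * (b - a) = arccos (\<gamma> a \<bullet> \<gamma> b)"
    unfolding minimal_geodesic_segment_def sphere_dist_def by blast
  have pts: "\<gamma> u \<in> pos_orthant" "norm (\<gamma> u) = 1" if "u \<in> {a..b}" for u
    using subsetD[OF C imageI[OF that]] by auto
  have ends: "a \<in> {a..b}" "b \<in> {a..b}" "t1 \<in> {a..b}" "t2 \<in> {a..b}" "t \<in> {a..b}"
    using ord t by auto
  \<comment> \<open>A positive inner product keeps the arc shorter than \<open>pi\<close>, so the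
    sines below have the right sign.\<close>
  have "0 < \<gamma> a \<bullet> \<gamma> b" "\<gamma> a \<bullet> \<gamma> b \<le> 1"
    using pts ends norm_cauchy_schwarz[of "\<gamma> a" "\<gamma> b"] by (auto intro: pos_orthant_inner_pos)
  then have "s * (b - a) < pi"
    unfolding d using arccos_less_arccos[of "- 1" "\<gamma> a \<bullet> \<gamma> b"] by simp
  define D e where "D = s * (t2 - t1)" and "e = s * (t - t1)"
  have De: "0 \<le> e" "e \<le> D"
    using s t by (auto simp: D_def e_def intro!: mult_left_mono)
  have "D \<le> s * (b - a)"
    unfolding D_def using s ord by (intro mult_left_mono) auto
  with \<open>s * (b - a) < pi\<close> have "D < pi" by simp
  define c where "c = max (quadratic_form A (\<gamma> t1)) (quadratic_form A (\<gamma> t2))"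
  show "quadratic_form A (\<gamma> t) \<le> max (quadratic_form A (\<gamma> t1)) (quadratic_form A (\<gamma> t2))"
  \<comment> \<open>For \<open>D = 0\<close> the interpolation below degenerates, since
    \<open>sin D = 0\<close>.\<close>
  proof (cases "D = 0 \<or> m \<le> c")
    case True
    then consider "D = 0" | "m \<le> c" by blast
    then show ?thesis
    proof cases
      case 1
      with De have "s * (t - a) = s * (t1 - a)"
        by (simp add: e_def algebra_simps)
      then have "\<gamma> t = \<gamma> t1"
        unfolding \<gamma>[OF ends(3)] \<gamma>[OF ends(5)] by (simp only:)
      then show ?thesis by simp
    next
      case 2
      have "\<gamma> t \<in> nonneg_orthant"
        using pts(1)[OF ends(5)] by (auto simp: pos_orthant_def nonneg_orthant_def less_imp_le)
      then have "quadratic_form A (\<gamma> t) \<le> m"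
        using cop pts(2)[OF ends(5)] unfolding copositive_shift_iff by fastforce
      with 2 show ?thesis unfolding c_def by linarith
    qed
  next
    case False
    with De have D: "0 < D" and cm: "c < m" by auto
    then have sD: "0 < sin D" and ss: "0 \<le> sin e" "0 \<le> sin (D - e)"
      using De \<open>D < pi\<close> by (auto intro!: sin_gt_zero sin_ge_zero)
    have t': "s * (t2 - a) = s * (t1 - a) + D" "s * (t - a) = s * (t1 - a) + e"
      by (auto simp: D_def e_def algebra_simps)
    \<comment> \<open>Spherical linear interpolation, multiplied by \<open>sin D\<close> to avoid
      division.\<close>
    have interpolate: "cos (u + e) * sin D = sin (D - e) * cos u + sin e * cos (u + D)"
      "sin (u + e) * sin D = sin (D - e) * sin u + sin e * sin (u + D)" for u
      by (simp_all add: sin_diff cos_add sin_add algebra_simps)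
    have z: "sin D *\<^sub>R \<gamma> t = sin (D - e) *\<^sub>R \<gamma> t1 + sin e *\<^sub>R \<gamma> t2"
      unfolding \<gamma>[OF ends(3)] \<gamma>[OF ends(4)] \<gamma>[OF ends(5)] t'
      by (simp add: scaleR_add_right mult.commute[of "sin D"] interpolate scaleR_add_left)
    have perp': "c * (norm w)\<^sup>2 \<le> quadratic_form A w" if "v \<bullet> w = 0" for w
      using perp[OF that] mult_right_mono[of c m "(norm w)\<^sup>2"] cm by simp
    have "quadratic_form A (sin (D - e) *\<^sub>R \<gamma> t1 + sin e *\<^sub>R \<gamma> t2)
        \<le> c * (norm (sin (D - e) *\<^sub>R \<gamma> t1 + sin e *\<^sub>R \<gamma> t2))\<^sup>2"
      using pts ends ss by (intro quadratic_form_le_on_cone[OF sym v perp']) (auto simp: c_def)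
    then have "(sin D)\<^sup>2 * quadratic_form A (\<gamma> t) \<le> (sin D)\<^sup>2 * c"
      unfolding z[symmetric] quadratic_form_scaleR using pts ends
      by (simp add: power_mult_distrib mult.commute)
    then show ?thesis
      using sD by (simp add: c_def)
  qed
qed

text \<open>The endpoint \<open>x\<close> carries the larger value, so along the geodesic to
  \<open>y\<close> the form never exceeds its value at \<open>x\<close>. Its derivative there is
  thus nonpositive, which bounds the contribution of the tangential part of
  \<open>y\<close>.\<close>

lemma quasiconvex_first_order:
  fixes A :: "real ^ 'n ^ 'n"
  assumes sym: "transpose A = A"
    and qc: "spherically_quasiconvex_on (sphere 0 1 \<inter> pos_orthant) (quadratic_form A)"
    and x: "x \<in> pos_orthant" "norm x = 1" and y: "y \<in> pos_orthant" "norm y = 1"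
    and le: "quadratic_form A y \<le> quadratic_form A x"
  shows "(A *v x) \<bullet> y \<le> (x \<bullet> y) * quadratic_form A x"
proof (cases "x = y")
  case True
  with x show ?thesis by (simp add: quadratic_form_def norm_eq_1)
next
  case False
  have xx: "x \<bullet> x = 1" "y \<bullet> y = 1"
    using x y by (auto simp: norm_eq_1)
  have c1: "x \<bullet> y \<le> 1" "0 < x \<bullet> y"
    using norm_cauchy_schwarz[of x y] x y by (auto intro: pos_orthant_inner_pos)
  have "x \<bullet> y \<noteq> 1"
    using False xx norm_cauchy_schwarz_eq[of x y] x y by simp
  with c1 have c2: "x \<bullet> y < 1" by simp
  define D where "D = arccos (x \<bullet> y)"
  have cosD: "cos D = x \<bullet> y"
    using c1 by (simp add: D_def)
  have D: "0 < D" "D < pi"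
    using arccos_lt_bounded[of "x \<bullet> y"] c1 c2 by (auto simp: D_def)
  then have sD: "0 < sin D" by (intro sin_gt_zero)
  \<comment> \<open>The unit tangent vector at \<open>x\<close> pointing towards
    \<open>y\<close>.\<close>
  define q where "q = (1 / sin D) *\<^sub>R (y - cos D *\<^sub>R x)"
  have yq: "y = cos D *\<^sub>R x + sin D *\<^sub>R q"
    using sD by (simp add: q_def)
  have "(norm (y - cos D *\<^sub>R x))\<^sup>2 = (sin D)\<^sup>2"
    unfolding power2_norm_eq_inner sin_squared_eq cosD
    by (simp add: inner_simps xx inner_commute power2_eq_square)
  then have "norm (y - cos D *\<^sub>R x) = sin D"
    using sD by (simp add: power2_eq_iff_nonneg)
  then have nq: "norm q = 1"
    using sD by (simp add: q_def)
  have xq: "x \<bullet> q = 0"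
    using xx by (simp add: q_def inner_simps cosD)
  define \<gamma> where "\<gamma> t = cos t *\<^sub>R x + sin t *\<^sub>R q" for t
  have \<gamma>0: "\<gamma> 0 = x" and \<gamma>D: "\<gamma> D = y"
    using yq by (auto simp: \<gamma>_def)
  have seg: "minimal_geodesic_segment \<gamma> 0 D"
    unfolding minimal_geodesic_segment_def \<gamma>0 \<gamma>D sphere_dist_def
    using D x nq xq by (intro conjI exI[of _ x] exI[of _ q] exI[of _ 1]) (auto simp: \<gamma>_def D_def)
  have "\<gamma> ` {0..D} \<subseteq> sphere 0 1 \<inter> pos_orthant"
    using spherically_convex_pos_orthant[where 'n = 'n] seg \<gamma>0 \<gamma>D x y
    unfolding spherically_convex_def by (metis IntI mem_sphere_0)
  then have "quadratic_form A (\<gamma> t) \<le> max (quadratic_form A (\<gamma> 0)) (quadratic_form A (\<gamma> D))"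
    if "t \<in> {0..D}" for t
    using qc seg that D unfolding spherically_quasiconvex_on_def by (metis order_refl less_imp_le)
  then have bound: "quadratic_form A (\<gamma> t) \<le> quadratic_form A x" if "t \<in> {0..D}" for t
    using that le unfolding \<gamma>0 \<gamma>D by fastforce
  define f where "f t = quadratic_form A (\<gamma> t)" for t
  have f: "f t = (cos t)\<^sup>2 * quadratic_form A x + 2 * cos t * sin t * ((A *v x) \<bullet> q)
      + (sin t)\<^sup>2 * quadratic_form A q" for t
    by (simp add: f_def \<gamma>_def quadratic_form_add[OF sym])
  have der: "(f has_real_derivative 2 * ((A *v x) \<bullet> q)) (at 0)"
    unfolding f by (auto intro!: derivative_eq_intros)
  have "(A *v x) \<bullet> q \<le> 0"
  proof (rule ccontr)
    assume "\<not> ?thesis"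
    then obtain d where d: "0 < d" "\<And>h. 0 < h \<Longrightarrow> h < d \<Longrightarrow> f 0 < f (0 + h)"
      using DERIV_pos_inc_right[OF der] by auto
    \<comment> \<open>Small enough both for the strict increase given by the derivative and for the
      segment.\<close>
    define h where "h = min (d / 2) D"
    have "f 0 < f h" using d(2)[of h] d(1) D by (auto simp: h_def)
    moreover have "f h \<le> f 0"
      using bound[of h] d(1) D \<gamma>0 by (auto simp: h_def f_def)
    ultimately show False by simp
  qed
  then have "sin D * ((A *v x) \<bullet> q) \<le> 0"
    using sD by (simp add: mult_le_0_iff)
  moreover have "(A *v x) \<bullet> y = cos D * quadratic_form A x + sin D * ((A *v x) \<bullet> q)"
    by (subst yq) (simp add: inner_simps quadratic_form_def)
  ultimately show ?thesis
    by (simp add: cosD)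
qed

text \<open>Normalize both vectors and exchange them if necessary. The maximum makes the bound
  symmetric and continuous, so limits can be taken without knowing which value is larger.\<close>

lemma quasiconvex_first_order_sym:
  fixes A :: "real ^ 'n ^ 'n"
  assumes sym: "transpose A = A"
    and qc: "spherically_quasiconvex_on (sphere 0 1 \<inter> pos_orthant) (quadratic_form A)"
    and x: "x \<in> pos_orthant" and y: "y \<in> pos_orthant"
  shows "(A *v x) \<bullet> y \<le>
    (x \<bullet> y) * max (quadratic_form A x / (norm x)\<^sup>2) (quadratic_form A y / (norm y)\<^sup>2)"
proof -
  have nz: "0 < norm x" "0 < norm y"
    using pos_orthant_inner_pos[OF x x] pos_orthant_inner_pos[OF y y] by auto
  define x' y' where "x' = (1 / norm x) *\<^sub>R x" and "y' = (1 / norm y) *\<^sub>R y"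
  have unit: "x' \<in> pos_orthant" "norm x' = 1" "y' \<in> pos_orthant" "norm y' = 1"
    using x y nz by (auto simp: x'_def y'_def pos_orthant_def)
  have q: "quadratic_form A x' = quadratic_form A x / (norm x)\<^sup>2"
    "quadratic_form A y' = quadratic_form A y / (norm y)\<^sup>2"
    by (auto simp: x'_def y'_def quadratic_form_scaleR power_divide)
  have "(A *v x') \<bullet> y' \<le> (x' \<bullet> y') * max (quadratic_form A x') (quadratic_form A y')"
  proof (cases "quadratic_form A y' \<le> quadratic_form A x'")
    case True
    then show ?thesis
      using quasiconvex_first_order[OF sym qc unit True] by (simp add: max_absorb1)
  next
    case False
    then show ?thesis
      using quasiconvex_first_order[OF sym qc unit(3,4,1,2)] symmetric_matrix_inner[OF sym, of x' y']
      by (simp add: max_absorb2 inner_commute)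
  qed
  moreover have "(A *v x') \<bullet> y' = ((A *v x) \<bullet> y) / (norm x * norm y)"
    and "x' \<bullet> y' = (x \<bullet> y) / (norm x * norm y)"
    by (auto simp: x'_def y'_def matrix_vector_mult_scaleR)
  ultimately have "((A *v x) \<bullet> y) / (norm x * norm y) \<le>
      ((x \<bullet> y) * max (quadratic_form A x') (quadratic_form A y')) / (norm x * norm y)"
    by simp
  then show ?thesis
    using nz unfolding q by (simp add: divide_le_cancel)
qed

text \<open>Positive perturbations of two coordinate vectors satisfy the first-order bound. In the
  limit its right side vanishes: the coordinate vectors are orthogonal and the maximum
  converges.\<close>

lemma quasiconvex_imp_Z_matrix:
  fixes A :: "real ^ 'n ^ 'n"
  assumes sym: "transpose A = A"
    and qc: "spherically_quasiconvex_on (sphere 0 1 \<inter> pos_orthant) (quadratic_form A)"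
  shows "Z_matrix A"
  unfolding Z_matrix_def
proof (intro allI impI)
  fix i j :: 'n
  assume ij: "i \<noteq> j"
  \<comment> \<open>Here \<open>1\<close> is the all-ones vector, which pushes
    \<open>axis k 1\<close> into the open orthant.\<close>
  define X where "X k e = axis k 1 + e *\<^sub>R (1 :: real ^ 'n)" for k e
  have pos: "X k e \<in> pos_orthant" if "0 < e" for k e
    using that by (auto simp: X_def pos_orthant_def axis_def)
  have lim: "(X k \<longlongrightarrow> axis k 1) (at_right 0)" for k
    unfolding X_def by (auto intro!: tendsto_eq_intros)
  have limA: "((\<lambda>e. A *v X k e) \<longlongrightarrow> A *v axis k 1) (at_right 0)" for k
    using lim by (intro bounded_linear.tendsto[OF matrix_vector_mul_bounded_linear])
  have limq: "((\<lambda>e. quadratic_form A (X k e) / (norm (X k e))\<^sup>2) \<longlongrightarrow>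
      quadratic_form A (axis k 1) / (norm (axis k 1 :: real ^ 'n))\<^sup>2) (at_right 0)" for k
    unfolding quadratic_form_def by (intro tendsto_intros lim limA) auto
  let ?r = "\<lambda>x. quadratic_form A x / (norm x)\<^sup>2"
  have "(A *v axis j 1) \<bullet> axis i 1 \<le>
      ((axis j 1 :: real ^ 'n) \<bullet> axis i 1) * max (?r (axis j 1)) (?r (axis i 1))"
  proof (rule tendsto_le)
    show "((\<lambda>e. (A *v X j e) \<bullet> X i e) \<longlongrightarrow> (A *v axis j 1) \<bullet> axis i 1) (at_right 0)"
      by (intro tendsto_intros lim limA)
    show "((\<lambda>e. (X j e \<bullet> X i e) * max (?r (X j e)) (?r (X i e))) \<longlongrightarrow>
        ((axis j 1 :: real ^ 'n) \<bullet> axis i 1) * max (?r (axis j 1)) (?r (axis i 1))) (at_right 0)"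
      by (rule tendsto_mult[OF tendsto_inner[OF lim lim] tendsto_max[OF limq limq]])
    show "\<forall>\<^sub>F e in at_right 0. (A *v X j e) \<bullet> X i e
        \<le> (X j e \<bullet> X i e) * max (?r (X j e)) (?r (X i e))"
      using quasiconvex_first_order_sym[OF sym qc pos pos]
      by (auto simp: eventually_at_filter)
  qed simp
  moreover have "(axis j 1 :: real ^ 'n) $ i = 0"
    using ij by (simp add: axis_def)
  ultimately show "A $ i $ j \<le> 0"
    by (simp add: inner_axis matrix_vector_mult_basis column_def)
qed

theorem theorem3:
  fixes A :: "real ^ 'n::{finite,linorder} ^ 'n::{finite,linorder}" and l :: "nat \<Rightarrow> real"
  assumes "transpose A = A"
    and "\<exists>c d. c \<noteq> d \<and> eigenvalue A c \<and> eigenvalue A d"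
    and "ordered_eigenvalues A l"
  shows "let
      st_i = spherically_quasiconvex_on (sphere 0 1 \<inter> pos_orthant) (quadratic_form A);
      st_ii = Z_matrix A;
      st_iii = (copositive (l 2 *\<^sub>R mat 1 - A) \<and> (\<exists>x\<in>nonneg_orthant. eigenvector A x (l 1)));
      st_iv = (Z_matrix A \<and> (\<forall>i. A $ i $ i \<le> l 2));
      st_v = (Z_matrix A \<and> l 1 < l 2 \<and> (\<forall>i. A $ i $ i \<le> l 2));
      st_vi = (irreducible_matrix A \<and> Z_matrix A \<and> (\<forall>i. A $ i $ i \<le> l 2))
    in (st_v \<longrightarrow> st_iii) \<and> (st_vi \<longrightarrow> st_iii) \<and> (st_iii \<longrightarrow> st_iv) \<and>
       (st_iii \<longrightarrow> st_i) \<and> (st_i \<longrightarrow> st_ii)"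
proof -
  let ?qc = "spherically_quasiconvex_on (sphere 0 1 \<inter> pos_orthant) (quadratic_form A)"
  let ?iii = "copositive (l 2 *\<^sub>R mat 1 - A) \<and> (\<exists>x\<in>nonneg_orthant. eigenvector A x (l 1))"
  \<comment> \<open>Both (v) and (vi) contain (iv), so their implications reduce to this
    one.\<close>
  have iv_iii: ?iii if "Z_matrix A" "\<forall>i. A $ i $ i \<le> l 2"
    using that Z_matrix_shift_copositive[of A "l 2"]
      Z_matrix_nonneg_eigenvector[OF assms(1,3)] by blast
  have iii_i: ?qc if iii: ?iii
  proof -
    from iii obtain v where v: "v \<in> nonneg_orthant" "eigenvector A v (l 1)" by blast
    then have "v \<noteq> 0" by (simp add: eigenvector_def)
    with iii v show ?thesis
      using second_eigenvalue_le_quadratic_form[OF assms(1,3) v(2)]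
      by (intro spherically_quasiconvex_quadratic_form[OF assms(1)]) auto
  qed
  have i_ii: "Z_matrix A" if ?qc
    using quasiconvex_imp_Z_matrix[OF assms(1) that] .
  \<comment> \<open>(iii) gives (iv) by passing through (i) to (ii) and adding the diagonal bound
    from copositivity.\<close>
  show ?thesis
    unfolding Let_def
    using iv_iii iii_i i_ii copositive_shift_diagonal_le[of "l 2" A] by blast
qed

end
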